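(* Let $n\ge2$ be an integer. For $a,b,c,d\in2\mathbb N$ define $$f(a,b,c,d)=\frac{I_n\begin{pmatrix}a&c\\ b&d\end{pmatrix}}{(a+d+n-2)!!\,(b+c+n-2)!!}.$$ Then $f$ is a symmetric function of $(a,b,c,d)$ on $(2\mathbb N)^4$, i.e. invariant under all permutations of its four arguments.
   Context: $I_n\begin{pmatrix}a&c\\ b&d\end{pmatrix}=\int_{O_n}u_{11}^a\,u_{12}^c\,u_{21}^b\,u_{22}^d\,du$ with respect to the Haar probability measure on $O_n$. Double factorial convention: for an integer $m\ge0$, $m!!=(m-1)(m-3)\cdots$, the product of the positive integers $\le m-1$ of the parity of $m-1$ (empty product $=1$). *)

theory Defs
  imports "HOL-Analysis.Analysis"
begin

text \<open>Double factorial, paper convention: m!! = (m-1)(m-3)..., the product of the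
  positive integers at most m-1 having the parity of m-1 (empty product = 1).\<close>
definition dfact :: "nat \<Rightarrow> nat" where
  "dfact m = (\<Prod>k\<in>{k\<in>{1..m-1}. even k = even (m-1)}. k)"

definition orth_group :: "(real^'n^'n) set" where
  "orth_group = {Q. orthogonal_matrix Q}"

text \<open>M is the Haar probability measure on O_n: a probability measure on the Borel
  sets of n x n matrices, concentrated on O_n, and invariant under left multiplication
  by orthogonal matrices (this characterizes the Haar measure uniquely).\<close>
definition haar_On :: "(real^'n^'n) measure \<Rightarrow> bool" where
  "haar_On M \<longleftrightarrow> sets M = sets borel \<and> emeasure M (space M) = 1
     \<and> emeasure M orth_group = 1
     \<and> (\<forall>Q. orthogonal_matrix Q \<longrightarrow> distr M borel (\<lambda>U. Q ** U) = M)"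

text \<open>I_n [[a,c],[b,d]] = integral of u11^a u12^c u21^b u22^d, where index i plays
  the role of 1 and index j (distinct from i) plays the role of 2.\<close>
definition I_n :: "(real^'n^'n) measure \<Rightarrow> 'n \<Rightarrow> 'n \<Rightarrow> nat \<Rightarrow> nat \<Rightarrow> nat \<Rightarrow> nat \<Rightarrow> real" where
  "I_n M i j a b c d =
     (\<integral>u. (u$i$i)^a * (u$i$j)^c * (u$j$i)^b * (u$j$j)^d \<partial>M)"

definition f_n :: "(real^'n^'n) measure \<Rightarrow> 'n \<Rightarrow> 'n \<Rightarrow> nat \<Rightarrow> nat \<Rightarrow> nat \<Rightarrow> nat \<Rightarrow> real" where
  "f_n M i j a b c d =
     I_n M i j a b c d / (real (dfact (a + d + CARD('n) - 2)) * real (dfact (b + c + CARD('n) - 2)))"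

end

theory Submission
  imports Defs "HOL-Probability.Probability_Measure"
begin

text \<open>Infinitesimal left rotations, applied to polynomials in the matrix entries and summed with
  the help of the orthonormality of the columns, yield linear recurrences between the moments of
  the \<open>2 \<times> 2\<close> corner. Eliminating from them the moments with odd exponents leaves, for even
  \<open>a, b\<close> and \<open>T = a + b + c + d\<close>,
  \<open>(a - b) (a + b + n - 3) (T + n - 2) f(a,b,c,d)
    = a (a - 1) f(a-2,b,c,d) - b (b - 1) f(a,b-2,c,d)\<close>,
  so that \<open>f(a,b,c,d) = f(b,a,c,d)\<close> by induction on \<open>a + b\<close>. Exchanging the two rows and
  transposing the matrix supply the remaining generators of the symmetric group.\<close>

section \<open>Planar orthogonal matrices\<close>

text \<open>The entries are arranged as Kronecker deltas in the column index \<open>l\<close>, so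
  that matrix products collapse. The same block form covers rotations and the exchange of two
  rows.\<close>

definition planar :: "'n::finite \<Rightarrow> 'n \<Rightarrow> real \<Rightarrow> real \<Rightarrow> real \<Rightarrow> real \<Rightarrow> real^'n^'n" where
  "planar i k \<alpha> \<beta> \<gamma> \<delta> = (\<chi> r l. (if l = r then (if r = i then \<alpha> else if r = k then \<delta> else 1) else 0)
     + ((if l = k then (if r = i then \<beta> else 0) else 0) + (if l = i then (if r = k then \<gamma> else 0) else 0)))"

lemma planar_mult_nth:
  assumes "i \<noteq> k"
  shows "(planar i k \<alpha> \<beta> \<gamma> \<delta> ** U) $ r $ p =
    (if r = i then \<alpha> * U $ i $ p + \<beta> * U $ k $ p
     else if r = k then \<gamma> * U $ i $ p + \<delta> * U $ k $ p else U $ r $ p)"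
  using assms
  by (simp add: planar_def matrix_matrix_mult_def distrib_right sum.distrib
      if_distrib[where f="\<lambda>x. x * _"] sum.delta cong: if_cong)

lemma orthogonal_planar:
  assumes "i \<noteq> k" "\<alpha>\<^sup>2 + \<beta>\<^sup>2 = 1" "\<gamma>\<^sup>2 + \<delta>\<^sup>2 = 1" "\<alpha> * \<gamma> + \<beta> * \<delta> = 0"
  shows "orthogonal_matrix (planar i k \<alpha> \<beta> \<gamma> \<delta>)"
proof -
  have "planar i k \<alpha> \<beta> \<gamma> \<delta> ** transpose (planar i k \<alpha> \<beta> \<gamma> \<delta>) = mat 1"
    unfolding vec_eq_iff planar_mult_nth[OF assms(1)]
    using assms by (auto simp: planar_def transpose_def mat_def power2_eq_square algebra_simps)
  then show ?thesis
    by (simp add: orthogonal_matrix_def matrix_left_right_inverse)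
qed

lemma orthogonal_matrix_columns:
  fixes U :: "real^'n^'n"
  assumes "orthogonal_matrix U"
  shows "(\<Sum>k\<in>UNIV. U $ k $ p * U $ k $ q) = (if p = q then 1 else 0)"
proof -
  have "(transpose U ** U) $ p $ q = (mat 1 :: real^'n^'n) $ p $ q"
    using assms by (simp add: orthogonal_matrix_def)
  then show ?thesis
    by (simp add: matrix_matrix_mult_def transpose_def mat_def)
qed

lemma orthogonal_matrix_entry_le_1:
  fixes U :: "real^'n^'n"
  assumes "orthogonal_matrix U"
  shows "\<bar>U $ r $ p\<bar> \<le> 1"
proof -
  have "(U $ r $ p)\<^sup>2 \<le> (\<Sum>k\<in>UNIV. (U $ k $ p)\<^sup>2)"
    by (intro member_le_sum) auto
  also have "\<dots> = 1"
    using orthogonal_matrix_columns[OF assms, of p p] by (simp add: power2_eq_square)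
  finally show ?thesis by (simp add: abs_square_le_1)
qed

section \<open>Infinitesimal rotations\<close>

definition rotation :: "'n::finite \<Rightarrow> 'n \<Rightarrow> real \<Rightarrow> real^'n^'n" where
  "rotation i k t = planar i k (cos t) (sin t) (- sin t) (cos t)"

lemma orthogonal_rotation: "i \<noteq> k \<Longrightarrow> orthogonal_matrix (rotation i k t)"
  unfolding rotation_def by (rule orthogonal_planar) auto

text \<open>The second-order remainder is uniform over the orthogonal group, which is what lets the
  expansion be integrated term by term.\<close>
definition has_rot_deriv ::
  "'n::finite \<Rightarrow> 'n \<Rightarrow> (real^'n^'n \<Rightarrow> real) \<Rightarrow> (real^'n^'n \<Rightarrow> real) \<Rightarrow> bool" where
  "has_rot_deriv i k F F' \<longleftrightarrow> continuous_on UNIV F \<and> continuous_on UNIV F' \<and>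
     (\<exists>C\<ge>0. \<forall>U. orthogonal_matrix U \<longrightarrow> \<bar>F U\<bar> \<le> C \<and> \<bar>F' U\<bar> \<le> C \<and>
       (\<forall>t. \<bar>t\<bar> \<le> 1 \<longrightarrow> \<bar>F (rotation i k t ** U) - F U - t * F' U\<bar> \<le> C * t\<^sup>2))"

lemma has_rot_derivI:
  assumes "continuous_on UNIV F" "continuous_on UNIV F'" "C \<ge> 0"
    and "\<And>U. orthogonal_matrix U \<Longrightarrow> \<bar>F U\<bar> \<le> C"
    and "\<And>U. orthogonal_matrix U \<Longrightarrow> \<bar>F' U\<bar> \<le> C"
    and "\<And>U t. orthogonal_matrix U \<Longrightarrow> \<bar>t\<bar> \<le> 1 \<Longrightarrow>
      \<bar>F (rotation i k t ** U) - F U - t * F' U\<bar> \<le> C * t\<^sup>2"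
  shows "has_rot_deriv i k F F'"
  using assms unfolding has_rot_deriv_def by blast

lemma has_rot_deriv_const: "has_rot_deriv i k (\<lambda>U. c) (\<lambda>U. 0)"
  by (rule has_rot_derivI[where C="\<bar>c\<bar>"]) auto

lemma has_rot_deriv_mult:
  assumes "has_rot_deriv i k F F'" "has_rot_deriv i k G G'"
  shows "has_rot_deriv i k (\<lambda>U. F U * G U) (\<lambda>U. F' U * G U + F U * G' U)"
proof -
  obtain C where C: "C \<ge> 0" "\<And>U. orthogonal_matrix U \<Longrightarrow> \<bar>F U\<bar> \<le> C"
      "\<And>U. orthogonal_matrix U \<Longrightarrow> \<bar>F' U\<bar> \<le> C"
      "\<And>U t. orthogonal_matrix U \<Longrightarrow> \<bar>t\<bar> \<le> 1 \<Longrightarrow>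
        \<bar>F (rotation i k t ** U) - F U - t * F' U\<bar> \<le> C * t\<^sup>2"
    and cF: "continuous_on UNIV F" "continuous_on UNIV F'"
    using assms(1) unfolding has_rot_deriv_def by blast
  obtain D where D: "D \<ge> 0" "\<And>U. orthogonal_matrix U \<Longrightarrow> \<bar>G U\<bar> \<le> D"
      "\<And>U. orthogonal_matrix U \<Longrightarrow> \<bar>G' U\<bar> \<le> D"
      "\<And>U t. orthogonal_matrix U \<Longrightarrow> \<bar>t\<bar> \<le> 1 \<Longrightarrow>
        \<bar>G (rotation i k t ** U) - G U - t * G' U\<bar> \<le> D * t\<^sup>2"
    and cG: "continuous_on UNIV G" "continuous_on UNIV G'"
    using assms(2) unfolding has_rot_deriv_def by blast
  \<comment> \<open>The constant is 3 + 2 + 1, one summand for each of the three parts into which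
    the remainder of the product splits; |t| \<le> 1 absorbs higher powers of \<open>t\<close> into
    \<open>t\<^sup>2\<close>.\<close>
  show ?thesis
  proof (rule has_rot_derivI[where C="6 * (C * D)"])
    show "continuous_on UNIV (\<lambda>U. F U * G U)" "continuous_on UNIV (\<lambda>U. F' U * G U + F U * G' U)"
      by (intro continuous_intros cF cG)+
    show "0 \<le> 6 * (C * D)" using C D by simp
    fix U :: "real^'a^'a" assume U: "orthogonal_matrix U"
    have CD: "0 \<le> C * D" using C D by simp
    have FG: "\<bar>F U * G U\<bar> \<le> C * D" "\<bar>F' U * G U\<bar> \<le> C * D" "\<bar>F U * G' U\<bar> \<le> C * D"
        "\<bar>F' U * G' U\<bar> \<le> C * D"
      unfolding abs_mult by (intro mult_mono C D U; simp)+
    then show "\<bar>F U * G U\<bar> \<le> 6 * (C * D)" "\<bar>F' U * G U + F U * G' U\<bar> \<le> 6 * (C * D)"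
      using CD by linarith+
    fix t :: real assume t: "\<bar>t\<bar> \<le> 1"
    define e where "e = F (rotation i k t ** U) - F U - t * F' U"
    define h where "h = G (rotation i k t ** U) - G U - t * G' U"
    have e: "\<bar>e\<bar> \<le> C * t\<^sup>2" and h: "\<bar>h\<bar> \<le> D * t\<^sup>2"
      unfolding e_def h_def by (intro C D U t)+
    have t2: "t\<^sup>2 \<le> 1" using t by (simp add: abs_square_le_1)
    have h1: "\<bar>h\<bar> \<le> D" using h D(1) t2 mult_left_mono[of "t\<^sup>2" 1 D] by linarith
    have tt: "\<bar>t * x\<bar> \<le> \<bar>x\<bar>" for x
      using t mult_right_mono[of "\<bar>t\<bar>" 1 "\<bar>x\<bar>"] by (simp add: abs_mult)
    have "\<bar>G U + t * G' U + h\<bar> \<le> 3 * D"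
      using D(2,3)[OF U] tt[of "G' U"] h1 by linarith
    then have 1: "\<bar>e * (G U + t * G' U + h)\<bar> \<le> (C * t\<^sup>2) * (3 * D)"
      unfolding abs_mult using e C D by (intro mult_mono) auto
    have "\<bar>F U + t * F' U\<bar> \<le> 2 * C"
      using C(2,3)[OF U] tt[of "F' U"] by linarith
    then have 2: "\<bar>(F U + t * F' U) * h\<bar> \<le> (2 * C) * (D * t\<^sup>2)"
      unfolding abs_mult using h C D by (intro mult_mono) auto
    have 3: "\<bar>t\<^sup>2 * (F' U * G' U)\<bar> \<le> t\<^sup>2 * (C * D)"
      unfolding abs_mult[of "t\<^sup>2"] using FG(4) by (simp add: mult_left_mono)
    have "F (rotation i k t ** U) = F U + t * F' U + e" "G (rotation i k t ** U) = G U + t * G' U + h"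
      by (simp_all add: e_def h_def)
    then have "F (rotation i k t ** U) * G (rotation i k t ** U) - F U * G U
        - t * (F' U * G U + F U * G' U)
      = e * (G U + t * G' U + h) + (F U + t * F' U) * h + t\<^sup>2 * (F' U * G' U)"
      by (simp add: algebra_simps power2_eq_square)
    then show "\<bar>F (rotation i k t ** U) * G (rotation i k t ** U) - F U * G U
        - t * (F' U * G U + F U * G' U)\<bar> \<le> 6 * (C * D) * t\<^sup>2"
      using 1 2 3 by (simp add: algebra_simps)
  qed
qed

lemma has_rot_deriv_power:
  assumes "has_rot_deriv i k F F'"
  shows "has_rot_deriv i k (\<lambda>U. F U ^ m) (\<lambda>U. real m * F U ^ (m - 1) * F' U)"
proof (induction m)
  case 0
  then show ?case using has_rot_deriv_const[of i k 1] by simp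
next
  case (Suc m)
  have "(\<lambda>U. F' U * F U ^ m + F U * (real m * F U ^ (m - 1) * F' U))
      = (\<lambda>U. real (Suc m) * F U ^ (Suc m - 1) * F' U)"
    by (cases m) (auto simp: algebra_simps)
  then show ?case using has_rot_deriv_mult[OF assms Suc] by simp
qed

lemma abs_one_minus_cos_le: "\<bar>cos t - 1\<bar> \<le> (t::real)\<^sup>2"
proof -
  have "\<bar>cos t - 1\<bar> = 2 * (sin (t/2))\<^sup>2"
    using cos_double_sin[of "t/2"] by simp
  also have "\<dots> \<le> 2 * (t/2)\<^sup>2"
    using abs_sin_x_le_abs_x[of "t/2"] by (simp only: abs_le_square_iff)
  also have "\<dots> \<le> t\<^sup>2" by (simp add: power_divide)
  finally show ?thesis .
qed

lemma abs_sin_minus_le: "\<bar>sin t - t\<bar> \<le> (t::real)\<^sup>2"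
proof -
  have "(\<Sum>m<2. sin_coeff m * t ^ m) = t"
    by (simp add: sin_coeff_def numeral_2_eq_2)
  then have "\<bar>sin t - t\<bar> * 2 \<le> t\<^sup>2"
    using Maclaurin_sin_bound[of t 2] by simp
  then show ?thesis by (rule order_trans[rotated]) simp
qed

lemma continuous_on_entry: "continuous_on S (\<lambda>U :: real^'n^'m. U $ r $ p)"
  by (intro continuous_intros)

text \<open>At \<open>t = 0\<close>, row \<open>i\<close> moves with velocity row \<open>k\<close>,
  and row \<open>k\<close> with minus row \<open>i\<close>. The remainders of cosine and sine cost
  \<open>t\<^sup>2\<close> each, whence the constant 2.\<close>

lemma has_rot_deriv_entry:
  assumes "i \<noteq> k"
  shows "has_rot_deriv i k (\<lambda>U. U $ r $ p)
    (\<lambda>U. (if r = i then U $ k $ p else 0) - (if r = k then U $ i $ p else 0))"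
proof (rule has_rot_derivI[where C=2])
  show "continuous_on UNIV (\<lambda>U :: real^'a^'a. U $ r $ p)" by (rule continuous_on_entry)
  show "continuous_on UNIV (\<lambda>U :: real^'a^'a. (if r = i then U $ k $ p else 0) - (if r = k then U $ i $ p else 0))"
    by (cases "r = i"; cases "r = k") (auto intro!: continuous_intros)
  fix U :: "real^'a^'a" assume U: "orthogonal_matrix U"
  note le = orthogonal_matrix_entry_le_1[OF U]
  show "\<bar>U $ r $ p\<bar> \<le> 2" using le[of r p] by simp
  show "\<bar>(if r = i then U $ k $ p else 0) - (if r = k then U $ i $ p else 0)\<bar> \<le> 2"
    using le[of k p] le[of i p] assms by auto
  fix t :: real assume t: "\<bar>t\<bar> \<le> 1"
  have b: "\<bar>(cos t - 1) * x\<bar> \<le> t\<^sup>2" "\<bar>(sin t - t) * x\<bar> \<le> t\<^sup>2" if "\<bar>x\<bar> \<le> 1" for x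
    unfolding abs_mult
    using mult_mono[OF abs_one_minus_cos_le[of t] that] mult_mono[OF abs_sin_minus_le[of t] that]
    by auto
  show "\<bar>(rotation i k t ** U) $ r $ p - U $ r $ p
      - t * ((if r = i then U $ k $ p else 0) - (if r = k then U $ i $ p else 0))\<bar> \<le> 2 * t\<^sup>2"
    unfolding rotation_def planar_mult_nth[OF assms]
    using assms b[OF le[of i p]] b[OF le[of k p]]
    by (auto simp: algebra_simps)
qed simp

section \<open>Integration against the Haar measure\<close>

lemma continuous_on_matrix_mult_left: "continuous_on S (\<lambda>U :: real^'n^'n. Q ** U)"
  unfolding matrix_matrix_mult_def by (intro continuous_intros)

locale haar_orth =
  fixes M :: "(real^'n^'n) measure"
  assumes haar: "haar_On M"
begin

lemma sets_M [measurable_cong]: "sets M = sets borel"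
  using haar by (simp add: haar_On_def)

lemma space_M: "space M = UNIV"
  using sets_eq_imp_space_eq[OF sets_M] by simp

sublocale prob_space M
  using haar by (intro prob_spaceI) (simp add: haar_On_def)

lemma AE_orthogonal: "AE U in M. orthogonal_matrix U"
proof -
  have 1: "emeasure M orth_group = 1" using haar by (simp add: haar_On_def)
  \<comment> \<open>A set outside the sigma-algebra has measure 0 by convention, so measure 1 forces
    measurability.\<close>
  then have "orth_group \<in> events" using emeasure_notin_sets[of orth_group M] by force
  moreover have "prob orth_group = 1" using 1 by (simp add: measure_def)
  ultimately have "AE U in M. U \<in> orth_group" by (simp add: AE_in_set_eq_1)
  then show ?thesis by (simp add: orth_group_def)
qed

lemma borel_measurable_continuous:
  fixes F :: "real^'n^'n \<Rightarrow> real"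
  assumes "continuous_on UNIV F"
  shows "F \<in> borel_measurable M"
  unfolding measurable_cong_sets[OF sets_M refl]
  by (rule borel_measurable_continuous_onI[OF assms])

lemma integrable_bounded_orthogonal:
  fixes F :: "real^'n^'n \<Rightarrow> real"
  assumes "continuous_on UNIV F" "\<And>U. orthogonal_matrix U \<Longrightarrow> \<bar>F U\<bar> \<le> C"
  shows "integrable M F"
  by (rule integrable_const_bound[where B=C])
    (use AE_orthogonal assms borel_measurable_continuous in auto)

lemma integral_mult_left_orthogonal:
  fixes F :: "real^'n^'n \<Rightarrow> real"
  assumes "orthogonal_matrix Q" "continuous_on UNIV F"
  shows "(\<integral>U. F (Q ** U) \<partial>M) = (\<integral>U. F U \<partial>M)"
proof -
  have "(\<lambda>U. Q ** U) \<in> measurable M borel"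
    unfolding measurable_cong_sets[OF sets_M refl]
    by (intro borel_measurable_continuous_onI continuous_on_matrix_mult_left)
  then have "(\<integral>U. F U \<partial>distr M borel (\<lambda>U. Q ** U)) = (\<integral>U. F (Q ** U) \<partial>M)"
    by (intro integral_distr borel_measurable_continuous_onI assms)
  then show ?thesis using haar assms(1) by (simp add: haar_On_def)
qed

lemma integrable_rot_deriv: "has_rot_deriv i k F F' \<Longrightarrow> integrable M F'"
  unfolding has_rot_deriv_def by (auto intro: integrable_bounded_orthogonal)

text \<open>Integration by parts on the group: by invariance the integrals of \<open>F\<close> and
  of its translate cancel, so \<open>t\<close> times the integral of \<open>F'\<close> is at most
  \<open>C * t\<^sup>2\<close> in absolute value. Divide by \<open>t\<close> and let it tend to
  0.\<close>

lemma integral_rot_deriv: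
  assumes "i \<noteq> k" "has_rot_deriv i k F F'"
  shows "(\<integral>U. F' U \<partial>M) = 0"
proof -
  obtain C where C: "C \<ge> 0" "\<And>U. orthogonal_matrix U \<Longrightarrow> \<bar>F U\<bar> \<le> C"
      "\<And>U. orthogonal_matrix U \<Longrightarrow> \<bar>F' U\<bar> \<le> C"
      "\<And>U t. orthogonal_matrix U \<Longrightarrow> \<bar>t\<bar> \<le> 1 \<Longrightarrow>
        \<bar>F (rotation i k t ** U) - F U - t * F' U\<bar> \<le> C * t\<^sup>2"
    and cF: "continuous_on UNIV F" "continuous_on UNIV F'"
    using assms(2) unfolding has_rot_deriv_def by blast
  have bound: "t * \<bar>\<integral>U. F' U \<partial>M\<bar> \<le> C * t\<^sup>2" if t: "0 < t" "t \<le> 1" for t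
  proof -
    let ?R = "rotation i k t"
    have cR: "continuous_on UNIV (\<lambda>U. F (?R ** U))"
      by (rule continuous_on_compose2[OF cF(1) continuous_on_matrix_mult_left]) auto
    have oR: "orthogonal_matrix (?R ** U)" if "orthogonal_matrix U" for U
      using that orthogonal_rotation[OF assms(1)] orthogonal_matrix_mul by blast
    have int: "integrable M F" "integrable M F'" "integrable M (\<lambda>U. F (?R ** U))"
      using cF cR C oR by (auto intro!: integrable_bounded_orthogonal[where C=C])
    have "(\<integral>U. F (?R ** U) - F U - t * F' U \<partial>M) = - t * (\<integral>U. F' U \<partial>M)"
      using int integral_mult_left_orthogonal[OF orthogonal_rotation[OF assms(1)] cF(1)]
      by simp
    then have "t * \<bar>\<integral>U. F' U \<partial>M\<bar> = \<bar>\<integral>U. F (?R ** U) - F U - t * F' U \<partial>M\<bar>"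
      using t by (simp add: abs_mult)
    also have "\<dots> \<le> (\<integral>U. \<bar>F (?R ** U) - F U - t * F' U\<bar> \<partial>M)"
      by (rule integral_abs_bound)
    also have "\<dots> \<le> C * t\<^sup>2"
      using int AE_orthogonal C(4) t by (intro integral_le_const) auto
    finally show ?thesis .
  qed
  have "\<bar>\<integral>U. F' U \<partial>M\<bar> \<le> 0"
  proof (rule field_le_epsilon)
    fix e :: real assume e: "0 < e"
    \<comment> \<open>The minimum keeps \<open>t\<close> in the range of the expansion, and
      \<open>C + 1\<close> avoids division by zero.\<close>
    define t where "t = min 1 (e / (C + 1))"
    have t: "0 < t" "t \<le> 1" "t \<le> e / (C + 1)" using e C(1) by (auto simp: t_def)
    have "\<bar>\<integral>U. F' U \<partial>M\<bar> \<le> C * t"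
      using bound[OF t(1,2)] t(1) by (simp add: power2_eq_square)
    also have "\<dots> \<le> C * (e / (C + 1))" using t C(1) by (intro mult_left_mono)
    also have "\<dots> \<le> e" using e C(1) by (simp add: field_simps)
    finally show "\<bar>\<integral>U. F' U \<partial>M\<bar> \<le> 0 + e" by simp
  qed
  then show ?thesis by simp
qed

text \<open>Integrate \<open>F (V\<^sup>T U)\<close> over both variables: left invariance in \<open>U\<close> gives the
  integral of \<open>F\<close>, left invariance in \<open>V\<close> that of its transpose. The truncation of \<open>F\<close>
  only serves to make the integrand bounded off the orthogonal group.\<close>
lemma integral_transpose:
  fixes F :: "real^'n^'n \<Rightarrow> real"
  assumes cF: "continuous_on UNIV F" and bF: "\<And>U. orthogonal_matrix U \<Longrightarrow> \<bar>F U\<bar> \<le> C"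
  shows "(\<integral>U. F (transpose U) \<partial>M) = (\<integral>U. F U \<partial>M)"
proof -
  define G where "G U = max (- C) (min C (F U))" for U
  have cG: "continuous_on UNIV G"
    unfolding G_def by (intro continuous_intros cF)
  have G_F: "G U = F U" if "orthogonal_matrix U" for U
    using bF[OF that] by (auto simp: G_def)
  have bG: "\<bar>G U\<bar> \<le> \<bar>C\<bar>" for U
    by (auto simp: G_def)
  have ctr: "continuous_on S (\<lambda>U :: real^'n^'n. transpose U)" for S
    unfolding transpose_def by (intro continuous_intros)
  have cGt: "continuous_on UNIV (\<lambda>U. G (transpose U))"
    by (rule continuous_on_compose2[OF cG ctr]) auto
  have const: "(\<integral>V. x \<partial>M) = x" for x :: real by (simp add: prob_space)
  interpret pair_prob_space M M ..
  let ?h = "\<lambda>V U :: real^'n^'n. G (transpose V ** U)"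
  have "continuous_on UNIV (\<lambda>p :: (real^'n^'n) \<times> (real^'n^'n). transpose (fst p) ** snd p)"
    unfolding transpose_def matrix_matrix_mult_def by (intro continuous_intros)
  then have "continuous_on UNIV (\<lambda>p. ?h (fst p) (snd p))"
    by (rule continuous_on_compose2[OF cG]) auto
  then have "(\<lambda>p. ?h (fst p) (snd p)) \<in> borel_measurable (M \<Otimes>\<^sub>M M)"
    unfolding measurable_cong_sets[OF sets_pair_measure_cong[OF sets_M sets_M] refl] borel_prod
    by (rule borel_measurable_continuous_onI)
  then have int: "integrable (M \<Otimes>\<^sub>M M) (\<lambda>(V, U). ?h V U)"
    by (intro P.integrable_const_bound[where B="\<bar>C\<bar>"]) (auto simp: bG split_beta')
  have inner1: "(\<integral>U. ?h V U \<partial>M) = (\<integral>U. G U \<partial>M)" if "orthogonal_matrix V" for V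
    using that by (intro integral_mult_left_orthogonal cG) simp
  have inner2: "(\<integral>V. ?h V U \<partial>M) = (\<integral>V. G (transpose V) \<partial>M)" if "orthogonal_matrix U" for U
  proof -
    \<comment> \<open>\<open>transpose V ** U\<close> is the transpose of
      \<open>transpose U ** V\<close>, so invariance under \<open>transpose U\<close> removes
      \<open>U\<close>.\<close>
    have "(\<integral>V. ?h V U \<partial>M) = (\<integral>V. G (transpose (transpose U ** V)) \<partial>M)"
      by (simp add: matrix_transpose_mul)
    also have "\<dots> = (\<integral>V. G (transpose V) \<partial>M)"
      using that by (intro integral_mult_left_orthogonal[OF _ cGt]) simp
    finally show ?thesis .
  qed
  have "(\<integral>U. G U \<partial>M) = (\<integral>V. (\<integral>U. G U \<partial>M) \<partial>M)" by (simp only: const)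
  also have "\<dots> = (\<integral>V. (\<integral>U. ?h V U \<partial>M) \<partial>M)"
    using AE_orthogonal inner1 int by (intro integral_cong_AE)
      (auto intro: integrable_fst' borel_measurable_integrable)
  also have "\<dots> = (\<integral>U. (\<integral>V. ?h V U \<partial>M) \<partial>M)"
    using Fubini_integral[OF int] by simp
  also have "\<dots> = (\<integral>U. (\<integral>V. G (transpose V) \<partial>M) \<partial>M)"
    using AE_orthogonal inner2 int by (intro integral_cong_AE)
      (auto intro: integrable_snd borel_measurable_integrable)
  also have "\<dots> = (\<integral>V. G (transpose V) \<partial>M)" by (simp only: const)
  finally have GG: "(\<integral>U. G U \<partial>M) = (\<integral>V. G (transpose V) \<partial>M)" .
  have "continuous_on UNIV (\<lambda>U. F (transpose U))"
    by (rule continuous_on_compose2[OF cF ctr]) auto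
  then have "(\<integral>U. F (transpose U) \<partial>M) = (\<integral>U. G (transpose U) \<partial>M)"
    using AE_orthogonal G_F cGt
    by (intro integral_cong_AE borel_measurable_continuous) auto
  moreover have "(\<integral>U. F U \<partial>M) = (\<integral>U. G U \<partial>M)"
    using AE_orthogonal G_F cG cF
    by (intro integral_cong_AE borel_measurable_continuous) auto
  ultimately show ?thesis using GG by simp
qed

end

section \<open>Recurrences for the corner moments\<close>

lemma dfact_add_2: "dfact (m + 2) = (m + 1) * dfact m"
proof -
  let ?S = "{k \<in> {1..m - 1}. even k = even (m - 1)}"
  \<comment> \<open>At \<open>m = 0\<close> truncation gives \<open>m - 1 = 0\<close>, of the wrong
    parity, but then the range \<open>{1..m - 1}\<close> is empty.\<close>
  have "{k \<in> {1..m + 2 - 1}. even k = even (m + 2 - 1)} = insert (m + 1) ?S"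
    by (cases m) (auto simp: le_Suc_eq)
  moreover have "\<Prod>(insert (m + 1) ?S) = (m + 1) * \<Prod>?S"
    by (rule prod.insert) auto
  ultimately show ?thesis unfolding dfact_def by (simp only:)
qed

locale haar_corner = haar_orth M for M :: "(real^'n^'n) measure" +
  fixes i j :: 'n
  assumes ij: "i \<noteq> j"
begin

text \<open>As in \<open>I_n\<close>, the exponents run down the columns: \<open>a\<close>,
  \<open>b\<close> belong to column \<open>i\<close> and \<open>c\<close>, \<open>d\<close> to
  column \<open>j\<close>. Thus transposition exchanges \<open>b\<close> with \<open>c\<close>, and
  the row exchange \<open>a\<close> with \<open>b\<close> and \<open>c\<close> with
  \<open>d\<close>.\<close>

definition mono :: "nat \<Rightarrow> nat \<Rightarrow> nat \<Rightarrow> nat \<Rightarrow> real^'n^'n \<Rightarrow> real" where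
  "mono a b c d U = (U$i$i)^a * (U$i$j)^c * (U$j$i)^b * (U$j$j)^d"

abbreviation J :: "nat \<Rightarrow> nat \<Rightarrow> nat \<Rightarrow> nat \<Rightarrow> real" where
  "J \<equiv> I_n M i j"

lemma J_eq: "J a b c d = (\<integral>U. mono a b c d U \<partial>M)"
  by (simp add: I_n_def mono_def)

lemma continuous_mono: "continuous_on S (mono a b c d)"
  unfolding mono_def by (intro continuous_intros)

lemma mono_le_1: "orthogonal_matrix U \<Longrightarrow> \<bar>mono a b c d U\<bar> \<le> 1"
  unfolding mono_def abs_mult power_abs
  by (intro mult_le_one power_le_one orthogonal_matrix_entry_le_1 mult_nonneg_nonneg) auto

lemma integrable_mono [simp]: "integrable M (mono a b c d)"
  by (rule integrable_bounded_orthogonal[OF continuous_mono mono_le_1])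

lemma J_transpose: "J a b c d = J a c b d"
proof -
  have "(\<integral>U. mono a c b d (transpose U) \<partial>M) = (\<integral>U. mono a c b d U \<partial>M)"
    by (rule integral_transpose[OF continuous_mono mono_le_1])
  then show ?thesis by (simp add: J_eq mono_def transpose_def mult_ac)
qed

lemma J_swap_rows: "J a b c d = J b a d c"
proof -
  have "orthogonal_matrix (planar i j 0 1 1 0)"
    by (rule orthogonal_planar[OF ij]) auto
  from integral_mult_left_orthogonal[OF this continuous_mono, of a b c d]
  show ?thesis using ij by (simp add: J_eq mono_def planar_mult_nth mult_ac)
qed

lemma has_rot_deriv_mono:
  assumes "i \<noteq> k"
  shows "has_rot_deriv i k (mono a b c d)
    (\<lambda>U. real a * mono (a - 1) b c d U * U$k$i + real c * mono a b (c - 1) d U * U$k$j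
       - (if k = j then real b * mono a (b - 1) c d U * U$i$i
            + real d * mono a b c (d - 1) U * U$i$j else 0))"
proof -
  note D = has_rot_deriv_power[OF has_rot_deriv_entry[OF assms]]
  note prod = has_rot_deriv_mult[OF has_rot_deriv_mult[OF has_rot_deriv_mult[OF
        D[of i i a] D[of i j c]] D[of j i b]] D[of j j d]]
  show ?thesis
    by (rule back_subst[where P="\<lambda>F. F", OF prod], rule arg_cong2[where f="has_rot_deriv i k"])
      (use assms ij in \<open>auto simp: fun_eq_iff mono_def algebra_simps\<close>)
qed

lemma mono_Suc:
  "mono (Suc a) b c d U = U$i$i * mono a b c d U"
  "mono a (Suc b) c d U = U$j$i * mono a b c d U"
  "mono a b (Suc c) d U = U$i$j * mono a b c d U"
  "mono a b c (Suc d) U = U$j$j * mono a b c d U"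
  by (simp_all add: mono_def)

text \<open>The coefficient absorbs truncated subtraction: at exponent 0 both sides vanish.\<close>

lemma mono_pred:
  "real a * (U$i$i * mono (a - 1) b c d U) = real a * mono a b c d U"
  "real b * (U$j$i * mono a (b - 1) c d U) = real b * mono a b c d U"
  "real c * (U$i$j * mono a b (c - 1) d U) = real c * mono a b c d U"
  "real d * (U$j$j * mono a b c (d - 1) U) = real d * mono a b c d U"
proof -
  show "real a * (U$i$i * mono (a - 1) b c d U) = real a * mono a b c d U"
    by (cases a) (auto simp: mono_Suc)
  show "real b * (U$j$i * mono a (b - 1) c d U) = real b * mono a b c d U"
    by (cases b) (auto simp: mono_Suc)
  show "real c * (U$i$j * mono a b (c - 1) d U) = real c * mono a b c d U"
    by (cases c) (auto simp: mono_Suc)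
  show "real d * (U$j$j * mono a b c (d - 1) U) = real d * mono a b c d U"
    by (cases d) (auto simp: mono_Suc)
qed

text \<open>Rotating rows \<open>i\<close> and \<open>j\<close> stays inside the corner, so the
  vanishing integral of the derivative is already a relation among corner moments.\<close>

lemma J_rotate_rows:
  "real a * J (a - 1) (b + 1) c d + real c * J a b (c - 1) (d + 1)
     = real b * J (a + 1) (b - 1) c d + real d * J a b (c + 1) (d - 1)"
proof -
  have "(\<integral>U. real a * mono (a - 1) (b + 1) c d U + real c * mono a b (c - 1) (d + 1) U
      - (real b * mono (a + 1) (b - 1) c d U + real d * mono a b (c + 1) (d - 1) U) \<partial>M) = 0"
    using integral_rot_deriv[OF ij has_rot_deriv_mono[OF ij, of a b c d]]
    by (simp add: mono_Suc mult_ac)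
  then show ?thesis by (simp add: J_eq)
qed

text \<open>Rotate row \<open>i\<close> against every other row \<open>k\<close>, test against the monomial times
  \<open>u\<^sub>k\<^sub>i\<close> and sum over \<open>k\<close>: by orthonormality of the columns no entry outside
  the corner survives.\<close>
lemma J_raise:
  "(real a + real b + real c + real CARD('n) - 1) * J (a + 1) b c d
     + real d * J a (b + 1) (c + 1) (d - 1) = real a * J (a - 1) b c d"
proof -
  \<comment> \<open>The product rule for the monomial times \<open>U$k$i\<close>; the last summand
    comes from the velocity \<open>- U$i$i\<close> of the extra factor.\<close>
  define F' where "F' k U = (real a * mono (a - 1) b c d U * U$k$i
       + real c * mono a b (c - 1) d U * U$k$j
       - (if k = j then real b * mono a (b - 1) c d U * U$i$i
            + real d * mono a b c (d - 1) U * U$i$j else 0)) * U$k$i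
       + mono a b c d U * (- U$i$i)" for k U
  have rot: "has_rot_deriv i k (\<lambda>U. mono a b c d U * U$k$i) (F' k)" if "k \<noteq> i" for k
    using has_rot_deriv_mult[OF has_rot_deriv_mono[of k a b c d] has_rot_deriv_entry[of i k k i]] that
    unfolding F'_def by (simp cong: if_cong)
  have int: "integrable M (F' k)" if "k \<noteq> i" for k
    by (rule integrable_rot_deriv[OF rot[OF that]])
  have "(\<integral>U. (\<Sum>k\<in>UNIV - {i}. F' k U) \<partial>M) = (\<Sum>k\<in>UNIV - {i}. \<integral>U. F' k U \<partial>M)"
    using int by (intro Bochner_Integration.integral_sum) auto
  also have "\<dots> = 0"
    using integral_rot_deriv[OF _ rot] by (intro sum.neutral) auto
  finally have zero: "(\<integral>U. (\<Sum>k\<in>UNIV - {i}. F' k U) \<partial>M) = 0" .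
  have eq: "(\<Sum>k\<in>UNIV - {i}. F' k U) = real a * mono (a - 1) b c d U
      - (real a + real b + real c + real CARD('n) - 1) * mono (a + 1) b c d U
      - real d * mono a (b + 1) (c + 1) (d - 1) U" if U: "orthogonal_matrix U" for U
  proof -
    have col: "(\<Sum>k\<in>UNIV - {i}. U$k$p * U$k$q) = (if p = q then 1 else 0) - U$i$p * U$i$q" for p q
      using orthogonal_matrix_columns[OF U, of p q] by (simp add: sum_diff1)
    have "(\<Sum>k\<in>UNIV - {i}. F' k U)
        = real a * mono (a - 1) b c d U * (\<Sum>k\<in>UNIV - {i}. U$k$i * U$k$i)
        + real c * mono a b (c - 1) d U * (\<Sum>k\<in>UNIV - {i}. U$k$j * U$k$i)
        - (\<Sum>k\<in>UNIV - {i}. if k = j then (real b * mono a (b - 1) c d U * U$i$i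
            + real d * mono a b c (d - 1) U * U$i$j) * U$k$i else 0)
        - (\<Sum>k\<in>UNIV - {i}. mono a b c d U * U$i$i)"
      unfolding F'_def sum_distrib_left sum.distrib[symmetric] sum_subtractf[symmetric]
      by (intro sum.cong) (auto simp: algebra_simps)
    also have "\<dots> = real a * mono (a - 1) b c d U * (1 - U$i$i * U$i$i)
        - real c * mono a b (c - 1) d U * (U$i$j * U$i$i)
        - (real b * mono a (b - 1) c d U * U$i$i + real d * mono a b c (d - 1) U * U$i$j) * U$j$i
        - (real CARD('n) - 1) * (mono a b c d U * U$i$i)"
      using ij by (simp add: col card_Diff_singleton of_nat_diff Suc_leI)
    also have "\<dots> = real a * mono (a - 1) b c d U
        - U$i$i * (real a * (U$i$i * mono (a - 1) b c d U))
        - U$i$i * (real c * (U$i$j * mono a b (c - 1) d U))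
        - U$i$i * (real b * (U$j$i * mono a (b - 1) c d U))
        - real d * (U$i$j * (U$j$i * mono a b c (d - 1) U))
        - (real CARD('n) - 1) * (U$i$i * mono a b c d U)"
      by (simp add: algebra_simps)
    also have "\<dots> = real a * mono (a - 1) b c d U
      - (real a + real b + real c + real CARD('n) - 1) * mono (a + 1) b c d U
      - real d * mono a (b + 1) (c + 1) (d - 1) U"
      unfolding mono_pred by (simp add: mono_Suc algebra_simps)
    finally show ?thesis .
  qed
  have "(\<integral>U. (\<Sum>k\<in>UNIV - {i}. F' k U) \<partial>M) = (\<integral>U. real a * mono (a - 1) b c d U
      - (real a + real b + real c + real CARD('n) - 1) * mono (a + 1) b c d U
      - real d * mono a (b + 1) (c + 1) (d - 1) U \<partial>M)"
    using AE_orthogonal eq int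
    by (intro integral_cong_AE)
      (auto intro!: borel_measurable_integrable Bochner_Integration.integrable_sum)
  with zero show ?thesis by (simp add: J_eq)
qed

text \<open>Eliminate the equal-degree term of the previous recurrence by means of its row-swapped
  instance.\<close>
lemma J_reduce:
  fixes a b c d :: nat
  defines "s \<equiv> real a + real b + real CARD('n) - 2"
  shows "s * (s + real c + real d + 1) * J (a + 1) b c d
    = real a * (s + real d) * J (a - 1) b c d - real b * real d * J a (b - 1) (c + 1) (d - 1)"
proof -
  have 1: "(s + real c + 1) * J (a + 1) b c d + real d * J a (b + 1) (c + 1) (d - 1)
      = real a * J (a - 1) b c d"
    using J_raise[of a b c d] by (simp add: s_def algebra_simps)
  \<comment> \<open>\<open>J_raise\<close> at exponents \<open>b\<close>, \<open>a\<close>,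
    \<open>d - 1\<close>, \<open>c + 1\<close> with the rows exchanged back; the factor
    \<open>real d\<close> makes the equation trivial at \<open>d = 0\<close>, where
    \<open>d - 1\<close> truncates.\<close>
  have 2: "real d * ((real c + 1) * J (a + 1) b c d + (s + real d) * J a (b + 1) (c + 1) (d - 1))
      = real d * (real b * J a (b - 1) (c + 1) (d - 1))"
  proof (cases d)
    case (Suc e)
    show ?thesis
      using J_raise[of b a e "c + 1"] J_swap_rows[of "a + 1" b c d]
        J_swap_rows[of a "b + 1" "c + 1" e] J_swap_rows[of a "b - 1" "c + 1" e] Suc
      by (simp add: s_def algebra_simps)
  qed simp
  \<comment> \<open>After subtracting \<open>2\<close>, the coefficient of
    \<open>J (a + 1) b c d\<close> is
    \<open>(s + d) * (s + c + 1) - d * (c + 1) = s * (s + c + d + 1)\<close>.\<close>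
  from 1 have "(s + real d) * ((s + real c + 1) * J (a + 1) b c d + real d * J a (b + 1) (c + 1) (d - 1))
      = (s + real d) * (real a * J (a - 1) b c d)" by simp
  with 2 show ?thesis by (simp add: algebra_simps)
qed

text \<open>\<open>J_reduce\<close> expresses the same moment by lowering \<open>a\<close> and, with
  rows exchanged, by lowering \<open>b\<close>. Weighting by \<open>a\<close> and \<open>b\<close>
  and subtracting gives the factor \<open>a - b\<close>; the moments with exponents
  \<open>a - 1\<close>, \<open>b - 1\<close> then cancel by \<open>J_rotate_rows\<close>.\<close>

lemma J_pair:
  fixes a b c d :: nat
  defines "n \<equiv> real CARD('n)"
  shows "(real a - real b) * (real a + real b + n - 3)
      * (real a + real b + real c + real d + n - 2) * J a b c d
    = real a * (real a - 1) * (real a + real d + n - 3) * J (a - 2) b c d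
      - real b * (real b - 1) * (real b + real c + n - 3) * J a (b - 2) c d"
proof -
  have E1: "real a * ((real a + real b + n - 3)
      * (real a + real b + real c + real d + n - 2) * J a b c d)
    = real a * ((real a - 1) * (real a + real b + real d + n - 3) * J (a - 2) b c d
      - real b * real d * J (a - 1) (b - 1) (c + 1) (d - 1))" for a b c d :: nat
  proof (cases a)
    case (Suc m)
    have "(real a + real b + n - 3) * (real a + real b + real c + real d + n - 2) * J a b c d
        = (real a - 1) * (real a + real b + real d + n - 3) * J (a - 2) b c d
          - real b * real d * J (a - 1) (b - 1) (c + 1) (d - 1)"
      using J_reduce[of m b c d] Suc by (simp add: n_def algebra_simps numeral_2_eq_2)
    then show ?thesis by simp
  qed simp
  have E2: "real b * ((real a + real b + n - 3)
      * (real a + real b + real c + real d + n - 2) * J a b c d)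
    = real b * ((real b - 1) * (real a + real b + real c + n - 3) * J a (b - 2) c d
      - real a * real c * J (a - 1) (b - 1) (c - 1) (d + 1))"
    using E1[of b a d c] unfolding J_swap_rows[of b] J_swap_rows[of "b - 2"] J_swap_rows[of "b - 1"]
    by (simp only: ac_simps)
  have R: "real a * real b * ((real a - 1) * J (a - 2) b c d + real c * J (a - 1) (b - 1) (c - 1) (d + 1))
      = real a * real b * ((real b - 1) * J a (b - 2) c d + real d * J (a - 1) (b - 1) (c + 1) (d - 1))"
  proof (cases "a = 0 \<or> b = 0")
    case False
    then obtain p q where "a = Suc p" "b = Suc q" by (meson not0_implies_Suc)
    then show ?thesis using J_rotate_rows[of p q c d] by (simp add: numeral_2_eq_2)
  qed auto
  let ?h = "real a + real b + n - 3" and ?t = "real a + real b + real c + real d + n - 2"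
  have "(real a - real b) * ?h * ?t * J a b c d
      = real a * (?h * ?t * J a b c d) - real b * (?h * ?t * J a b c d)"
    by (simp only: left_diff_distrib mult.assoc)
  also have "\<dots> = real a * ((real a - 1) * (real a + real b + real d + n - 3) * J (a - 2) b c d
        - real b * real d * J (a - 1) (b - 1) (c + 1) (d - 1))
      - real b * ((real b - 1) * (real a + real b + real c + n - 3) * J a (b - 2) c d
        - real a * real c * J (a - 1) (b - 1) (c - 1) (d + 1))"
    by (simp only: E1 E2)
  \<comment> \<open>Splitting \<open>a + b + d + n - 3\<close> as
    \<open>(a + d + n - 3) + b\<close>, and its counterpart as \<open>(b + c + n - 3) + a\<close>,
    isolates the combination that \<open>R\<close> annihilates.\<close>
  also have "\<dots> = real a * (real a - 1) * (real a + real d + n - 3) * J (a - 2) b c d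
      - real b * (real b - 1) * (real b + real c + n - 3) * J a (b - 2) c d
      + (real a * real b * ((real a - 1) * J (a - 2) b c d
          + real c * J (a - 1) (b - 1) (c - 1) (d + 1))
        - real a * real b * ((real b - 1) * J a (b - 2) c d
          + real d * J (a - 1) (b - 1) (c + 1) (d - 1)))"
    by (simp only: algebra_simps)
  finally show ?thesis unfolding R by simp
qed

section \<open>Normalised moments and their symmetries\<close>

text \<open>The factors \<open>a + d + n - 3\<close> and \<open>b + c + n - 3\<close> in
  \<open>J_pair\<close> are the ratios by which the two double factorials change when
  \<open>a\<close> or \<open>b\<close> drops by 2, so the normalisation absorbs them.\<close>

lemma f_n_pair:
  fixes a b c d :: nat
  defines "n \<equiv> real CARD('n)"
  assumes "CARD('n) \<ge> 2" "even a" "even b"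
  shows "(real a - real b) * (real a + real b + n - 3)
      * (real a + real b + real c + real d + n - 2) * f_n M i j a b c d
    = real a * (real a - 1) * f_n M i j (a - 2) b c d
      - real b * (real b - 1) * f_n M i j a (b - 2) c d"
proof -
  define N where "N = CARD('n) - 2"
  have n: "n = real N + 2" and N: "x + CARD('n) - 2 = x + N" for x
    using assms(2) by (simp_all add: n_def N_def)
  let ?D = "\<lambda>x y. real (dfact (x + y + N))"
  \<comment> \<open>Evenness excludes \<open>x = 1\<close>: either \<open>x - 2\<close> is a genuine
    subtraction or the coefficient \<open>real x\<close> is 0.\<close>
  have step: "real x * z * J' / ?D (x - 2) y = real x * z * (real x + real y + n - 3) * J' / ?D x y"
    if "even x" for x y :: nat and z J' :: real
  proof (cases "x = 0")
    case False
    define m where "m = x - 2"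
    have x: "x = m + 2" using False that unfolding m_def by presburger
    let ?w = "real m + real y + real N + 1"
    have D: "?D x y = ?w * ?D (x - 2) y"
      using dfact_add_2[of "m + y + N"] by (simp add: x algebra_simps)
    have w: "real x + real y + n - 3 = ?w"
      by (simp add: x n)
    have "?w \<noteq> 0" by linarith
    then have "real x * z * J' / ?D (x - 2) y = ?w * (real x * z * J') / (?w * ?D (x - 2) y)"
      by (rule mult_divide_mult_cancel_left[symmetric])
    then show ?thesis unfolding D w by (simp only: mult_ac)
  qed simp
  have "real a * (real a - 1) * f_n M i j (a - 2) b c d
      = real a * (real a - 1) * (real a + real d + n - 3) * J (a - 2) b c d / (?D a d * ?D b c)"
    using step[OF assms(3), of "real a - 1" "J (a - 2) b c d" d]
    by (simp add: f_n_def N flip: divide_divide_eq_left)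
  moreover have "real b * (real b - 1) * f_n M i j a (b - 2) c d
      = real b * (real b - 1) * (real b + real c + n - 3) * J a (b - 2) c d / (?D a d * ?D b c)"
    using step[OF assms(4), of "real b - 1" "J a (b - 2) c d" c]
    by (simp add: f_n_def N mult.commute[of "?D a d"] flip: divide_divide_eq_left)
  moreover have "f_n M i j a b c d = J a b c d / (?D a d * ?D b c)"
    by (simp add: f_n_def N)
  ultimately show ?thesis
    using J_pair[of a b c d]
    by (simp only: n_def times_divide_eq_right diff_divide_distrib[symmetric])
qed

text \<open>Both sides satisfy the same recurrence of the preceding lemma, whose leading factor does
  not vanish when \<open>a \<noteq> b\<close> are even.\<close>
lemma f_n_swap_1_2:
  assumes "CARD('n) \<ge> 2"
  shows "even a \<Longrightarrow> even b \<Longrightarrow> f_n M i j a b c d = f_n M i j b a c d"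
proof (induction "a + b" arbitrary: a b rule: less_induct)
  case less
  show ?case
  proof (cases "a = b")
    case False
    let ?n = "real CARD('n)"
    let ?k = "(real a - real b) * (real a + real b + ?n - 3)
      * (real a + real b + real c + real d + ?n - 2)"
    \<comment> \<open>Distinct even numbers have sum at least 2, which makes both factors below
      positive even for \<open>n = 2\<close>.\<close>
    have "a + b \<ge> 2" using False less.prems by (auto elim!: evenE)
    then have "real a + real b \<ge> 2" by linarith
    moreover have "?n \<ge> 2" using assms by simp
    ultimately have "real a + real b + ?n - 3 > 0" "real a + real b + real c + real d + ?n - 2 > 0"
      by linarith+
    then have k: "?k \<noteq> 0" using False by simp
    have IH1: "real a * (real a - 1) * f_n M i j (a - 2) b c d
        = real a * (real a - 1) * f_n M i j b (a - 2) c d"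
      using less.hyps[of "a - 2" b] less.prems by (cases "a = 0") auto
    have IH2: "real b * (real b - 1) * f_n M i j a (b - 2) c d
        = real b * (real b - 1) * f_n M i j (b - 2) a c d"
      using less.hyps[of a "b - 2"] less.prems by (cases "b = 0") auto
    have "?k * f_n M i j a b c d = - ((real b - real a) * (real b + real a + ?n - 3)
      * (real b + real a + real c + real d + ?n - 2) * f_n M i j b a c d)"
      unfolding f_n_pair[OF assms less.prems] f_n_pair[OF assms less.prems(2,1)] IH1 IH2 by simp
    also have "\<dots> = ?k * f_n M i j b a c d"
      by (simp add: add.commute[of "real b" "real a"] left_diff_distrib)
    finally show ?thesis using k by simp
  qed simp
qed

text \<open>Transposition fixes both \<open>a + d\<close> and \<open>b + c\<close>; the row exchange
  below interchanges them, permuting only the factors of the denominator.\<close>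

lemma f_n_swap_2_3: "f_n M i j a b c d = f_n M i j a c b d"
  by (simp add: f_n_def J_transpose[of a b] add.commute)

lemma f_n_swap_rows: "f_n M i j a b c d = f_n M i j b a d c"
  by (simp add: f_n_def J_swap_rows[of a b] add.commute mult.commute)

text \<open>Swap the first two arguments, then exchange the rows: \<open>a\<close>, \<open>b\<close>
  return to their places while \<open>c\<close>, \<open>d\<close> are interchanged.\<close>

lemma f_n_swap_3_4:
  assumes "CARD('n) \<ge> 2" "even a" "even b"
  shows "f_n M i j a b c d = f_n M i j a b d c"
  using f_n_swap_1_2[OF assms] f_n_swap_rows[of b a] by simp

end

section \<open>From adjacent transpositions to all permutations\<close>

theorem theorem7p1:
  fixes M :: "(real^'n^'n) measure" and i j :: 'n and x :: "nat \<Rightarrow> nat" and \<sigma> :: "nat \<Rightarrow> nat"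
  assumes "CARD('n) \<ge> 2"
    and "haar_On M"
    and "i \<noteq> j"
    and "\<forall>k<4. even (x k)"
    and "\<sigma> permutes {..<4}"
  shows "f_n M i j (x 0) (x 1) (x 2) (x 3) = f_n M i j (x (\<sigma> 0)) (x (\<sigma> 1)) (x (\<sigma> 2)) (x (\<sigma> 3))"
proof -
  interpret haar_corner M i j
    using assms(2,3) by unfold_locales
  note swaps = f_n_swap_1_2[OF assms(1)] f_n_swap_2_3 f_n_swap_3_4[OF assms(1)]
  let ?f = "\<lambda>y. f_n M i j (y 0) (y 1) (y 2) (y 3)"
  let ?E = "\<lambda>y :: nat \<Rightarrow> nat. \<forall>k<4. even (y k)"
  \<comment> \<open>Each of the six transpositions is a product of the adjacent ones in
    \<open>swaps\<close>; as all four values are even, the parity hypotheses persist along the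
    way.\<close>
  have transp: "?f (y \<circ> Transposition.transpose p q) = ?f y"
    if y: "?E y" and pq: "p < q" "q < 4" for y p q
  proof -
    have e: "even (y 0)" "even (y 1)" "even (y 2)" "even (y 3)" using y by auto
    have "(p, q) \<in> {(0,1), (0,2), (0,3), (1,2), (1,3), (2,3)}"
      using pq by auto
    then show ?thesis
      using e by (elim insertE; simp add: Transposition.transpose_def) (metis swaps)+
  qed
  have transp: "?f (y \<circ> Transposition.transpose p q) = ?f y"
    if "?E y" "p < 4" "q < 4" for y p q
    using transp[OF that(1), of p q] transp[OF that(1), of q p] that(2,3)
    by (cases p q rule: linorder_cases) (auto simp: transpose_commute)
  have fin: "finite {..<4::nat}" by simp
  \<comment> \<open>Induction over products of transpositions; \<open>y\<close> is quantified
    because the hypothesis for \<open>\<tau>\<close> is applied to \<open>y\<close> composed with a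
    transposition.\<close>
  from assms(5) fin have "\<forall>y. ?E y \<longrightarrow> ?f (y \<circ> \<sigma>) = ?f y"
  proof (induction rule: permutes_induct)
    case id
    show ?case by simp
  next
    case (swap p q \<tau>)
    show ?case
    proof (intro allI impI)
      fix y assume y: "?E y"
      let ?y = "y \<circ> Transposition.transpose p q"
      have "?E ?y"
        using y swap.hyps(1,2) by (auto simp: Transposition.transpose_def)
      then have "?f (?y \<circ> \<tau>) = ?f ?y" using swap.IH by blast
      also have "\<dots> = ?f y" using transp[OF y] swap.hyps(1,2) by simp
      finally show "?f (y \<circ> (Transposition.transpose p q \<circ> \<tau>)) = ?f y" by simp
    qed
  qed
  then show ?thesis using assms(4) by simp
qed

end
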